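(* Let $B,R>0$. There is no infinite sequence of positive real numbers $(h_k)_{k\ge1}$ with the following property: for every integer $N\ge1$, every dimension $n$, every nonempty closed convex set $X\subseteq\mathbb{R}^n$, every convex function $f$ whose domain contains $X$, with nonempty subdifferential at every point of $X$ and with $B$-bounded subgradients on $X$, every minimizer $x^*$ of $f$ over $X$, every $x^1\in X$ with $\|x^1-x^*\|\le R$, and every $x^2,\dots,x^{N+1}$ generated by $x^{k+1}=P_X(x^k-h_kg^k)$ with $g^k\in\partial f(x^k)$, $k=1,\dots,N$, one has $$f(x^{N+1})-f(x^* )\le\frac{BR}{\sqrt{N+1}}.$$
   Context: $\|\cdot\|$ is the Euclidean norm and $P_X$ is the Euclidean projection onto $X$. The subdifferential is $\partial f(x)=\{g\in\mathbb{R}^n : f(y)\ge f(x)+\langle g,y-x\rangle \text{ for all } y\in\mathrm{dom} f\}$. The function $f$ has $B$-bounded subgradients on $X$ if $\|g\|\le B$ for all $x\in X$ and $g\in\partial f(x)$. *)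

theory Defs
  imports "HOL-Analysis.Analysis" "HOL-Library.Function_Algebras"
begin

text \<open>
  The dimension is quantified inside the statement, so it cannot be an index type. The space
  \<open>\<real>\<^sup>n\<close> is the carrier of the library topology \<^term>\<open>Euclidean_space n\<close>, i.e. the functions
  \<open>nat \<Rightarrow> real\<close> vanishing at all indices \<open>i \<ge> n\<close>. The pointwise vector space structure below
  makes \<^const>\<open>convex\<close> and \<^const>\<open>convex_on\<close> available for them.
\<close>

instantiation "fun" :: (type, real_vector) real_vector
begin

definition scaleR_fun_def: "c *\<^sub>R x = (\<lambda>i. c *\<^sub>R x i)"

instance
  by standard (simp_all add: scaleR_fun_def plus_fun_def fun_eq_iff algebra_simps)

end

definition eucl_inner :: "nat \<Rightarrow> (nat \<Rightarrow> real) \<Rightarrow> (nat \<Rightarrow> real) \<Rightarrow> real"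
  where "eucl_inner n x y = (\<Sum>i<n. x i * y i)"

definition eucl_norm :: "nat \<Rightarrow> (nat \<Rightarrow> real) \<Rightarrow> real"
  where "eucl_norm n x = L2_set x {..<n}"

text \<open>As for \<^const>\<open>closest_point\<close>, this is only meaningful where a nearest point exists uniquely,
  e.g. for \<open>X\<close> nonempty, closed and convex.\<close>

definition eucl_proj :: "nat \<Rightarrow> (nat \<Rightarrow> real) set \<Rightarrow> (nat \<Rightarrow> real) \<Rightarrow> (nat \<Rightarrow> real)"
  where "eucl_proj n X y = arg_min_on (\<lambda>p. eucl_norm n (y - p)) X"

text \<open>A function with values in \<open>\<real> \<union> {\<infinity>}\<close> is represented by its domain \<open>D\<close> and its real values
  on \<open>D\<close>; the values of \<open>f\<close> outside \<open>D\<close> are never used.\<close>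

definition subdifferential ::
    "nat \<Rightarrow> (nat \<Rightarrow> real) set \<Rightarrow> ((nat \<Rightarrow> real) \<Rightarrow> real) \<Rightarrow> (nat \<Rightarrow> real) \<Rightarrow> (nat \<Rightarrow> real) set"
  where "subdifferential n D f x =
    {g \<in> topspace (Euclidean_space n). \<forall>y\<in>D. f y \<ge> f x + eucl_inner n g (y - x)}"

definition bounded_subgradients_on ::
    "nat \<Rightarrow> (nat \<Rightarrow> real) set \<Rightarrow> ((nat \<Rightarrow> real) \<Rightarrow> real) \<Rightarrow> real \<Rightarrow> (nat \<Rightarrow> real) set \<Rightarrow> bool"
  where "bounded_subgradients_on n D f B X \<longleftrightarrow>
    (\<forall>x\<in>X. \<forall>g\<in>subdifferential n D f x. eucl_norm n g \<le> B)"

end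

theory Submission
  imports Defs
begin

text \<open>
  Two piecewise linear functions \<open>f = max(0, max\<^sub>i \<langle>g\<^sub>i, \<cdot>\<rangle>)\<close>, minimized over the whole space at
  \<open>0\<close>, impose incompatible conditions on \<open>h\<^sub>1\<close>. Normalize \<open>B = R = 1\<close> and let \<open>x\<^sup>1\<close> be a unit
  vector with \<open>\<langle>g\<^sub>i, x\<^sup>1\<rangle> = t\<close> for all \<open>i\<close>.
  For \<open>N = 1\<close> and \<open>g\<^sub>1, g\<^sub>2\<close> at an angle slightly larger than \<open>\<pi>/2\<close>, the value
  \<open>\<langle>g\<^sub>2, x\<^sup>2\<rangle> = t - h\<^sub>1 \<langle>g\<^sub>1, g\<^sub>2\<rangle>\<close> exceeds \<open>1/\<surd>2\<close> unless \<open>h\<^sub>1\<close> is at most about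
  \<open>1/(2\<surd>2) = 0.3535\<dots>\<close>.
  For \<open>N = 2\<close>, take \<open>\<langle>g\<^sub>1, g\<^sub>2\<rangle> = \<langle>g\<^sub>1, g\<^sub>3\<rangle> = c > 0\<close> small and \<open>\<langle>g\<^sub>2, g\<^sub>3\<rangle> \<le> 0\<close>; then
  \<open>\<langle>g\<^sub>3, x\<^sup>3\<rangle> \<ge> t - h\<^sub>1 c\<close> whatever \<open>h\<^sub>2 > 0\<close> is, and this exceeds \<open>1/\<surd>3\<close> unless \<open>h\<^sub>1\<close> is at
  least about \<open>2/(3\<surd>3) = 0.3849\<dots>\<close>. Rational vectors of norm at most 1
  close to these configurations still keep the two bounds apart.
\<close>

section \<open>Inner product, norm and projection on the carrier of
  \<open>Euclidean_space n\<close>\<close>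

lemma eucl_inner_add_right: "eucl_inner n a (x + y) = eucl_inner n a x + eucl_inner n a y"
  by (simp add: eucl_inner_def distrib_left sum.distrib)

lemma eucl_inner_diff_right: "eucl_inner n a (x - y) = eucl_inner n a x - eucl_inner n a y"
  by (simp add: eucl_inner_def right_diff_distrib sum_subtractf)

lemma eucl_inner_scaleR_right: "eucl_inner n a (c *\<^sub>R x) = c * eucl_inner n a x"
  by (simp add: eucl_inner_def scaleR_fun_def sum_distrib_left mult.left_commute)

lemma eucl_inner_scaleR_left: "eucl_inner n (c *\<^sub>R a) x = c * eucl_inner n a x"
  by (simp add: eucl_inner_def scaleR_fun_def sum_distrib_left mult.assoc)

lemma eucl_inner_zero_left: "eucl_inner n 0 x = 0"
  by (simp add: eucl_inner_def)

lemma eucl_inner_self: "eucl_inner n x x = (eucl_norm n x)\<^sup>2"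
  by (simp add: eucl_inner_def eucl_norm_def L2_set_def sum_nonneg power2_eq_square)

lemma eucl_norm_nonneg: "eucl_norm n x \<ge> 0"
  by (simp add: eucl_norm_def L2_set_nonneg)

lemma eucl_norm_scaleR: "eucl_norm n (c *\<^sub>R x) = \<bar>c\<bar> * eucl_norm n x"
  unfolding eucl_norm_def L2_set_def scaleR_fun_def
  by (simp add: power_mult_distrib real_sqrt_mult flip: sum_distrib_left)

lemma eucl_inner_le_norm: "eucl_inner n x y \<le> eucl_norm n x * eucl_norm n y"
proof -
  have "eucl_inner n x y \<le> (\<Sum>i<n. \<bar>x i\<bar> * \<bar>y i\<bar>)"
    unfolding eucl_inner_def by (rule sum_mono) (simp flip: abs_mult)
  also have "\<dots> \<le> eucl_norm n x * eucl_norm n y"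
    unfolding eucl_norm_def by (rule L2_set_mult_ineq)
  finally show ?thesis .
qed

lemma eucl_norm_eq_0_iff:
  assumes "x \<in> topspace (Euclidean_space n)"
  shows "eucl_norm n x = 0 \<longleftrightarrow> x = 0"
proof
  assume "eucl_norm n x = 0"
  then have "x i = 0" for i
    using assms by (cases "i < n") (auto simp: eucl_norm_def topspace_Euclidean_space L2_set_eq_0_iff)
  then show "x = 0"
    by (simp add: fun_eq_iff)
qed (simp add: eucl_norm_def L2_set_eq_0_iff)

lemma Euclidean_space_closed_under:
  shows "0 \<in> topspace (Euclidean_space n)"
    and "x \<in> topspace (Euclidean_space n) \<Longrightarrow> c *\<^sub>R x \<in> topspace (Euclidean_space n)"
    and "x \<in> topspace (Euclidean_space n) \<Longrightarrow> y \<in> topspace (Euclidean_space n)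
      \<Longrightarrow> x + y \<in> topspace (Euclidean_space n)"
    and "x \<in> topspace (Euclidean_space n) \<Longrightarrow> y \<in> topspace (Euclidean_space n)
      \<Longrightarrow> x - y \<in> topspace (Euclidean_space n)"
  by (simp_all add: topspace_Euclidean_space scaleR_fun_def)

lemma convex_topspace_Euclidean_space: "convex (topspace (Euclidean_space n))"
  by (simp add: convex_def Euclidean_space_closed_under)

text \<open>The point itself is at distance 0, and the norm is definite on the carrier. Hence over
  the whole space a projected step is a plain subgradient step.\<close>

lemma eucl_proj_topspace:
  assumes y: "y \<in> topspace (Euclidean_space n)"
  shows "eucl_proj n (topspace (Euclidean_space n)) y = y"
proof -
  let ?S = "topspace (Euclidean_space n)"
  have zero: "eucl_norm n (y - y) = 0"
    using eucl_norm_eq_0_iff[OF Euclidean_space_closed_under(1)[of n]] by simp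
  have "is_arg_min (\<lambda>p. eucl_norm n (y - p)) (\<lambda>p. p \<in> ?S) y"
    using y zero eucl_norm_nonneg by (simp add: is_arg_min_linorder)
  then have "is_arg_min (\<lambda>p. eucl_norm n (y - p)) (\<lambda>p. p \<in> ?S) (eucl_proj n ?S y)"
    unfolding eucl_proj_def arg_min_on_def arg_min_def
    by (rule someI[of "is_arg_min (\<lambda>p. eucl_norm n (y - p)) (\<lambda>p. p \<in> ?S)"])
  then have mem: "eucl_proj n ?S y \<in> ?S" and "eucl_norm n (y - eucl_proj n ?S y) \<le> 0"
    using y zero by (auto simp: is_arg_min_linorder)
  then have "y - eucl_proj n ?S y = 0"
    using eucl_norm_eq_0_iff[OF Euclidean_space_closed_under(4)[OF y mem]] eucl_norm_nonneg
    by (meson order_antisym)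
  then show ?thesis
    by simp
qed

section \<open>Maxima of finitely many linear functionals and their subgradients\<close>

definition max_linear :: "nat \<Rightarrow> (nat \<Rightarrow> real) set \<Rightarrow> (nat \<Rightarrow> real) \<Rightarrow> real"
  where "max_linear n A z = Max ((\<lambda>a. eucl_inner n a z) ` A)"

lemma max_linear_ge: "finite A \<Longrightarrow> a \<in> A \<Longrightarrow> eucl_inner n a z \<le> max_linear n A z"
  by (simp add: max_linear_def)

lemma max_linear_attained:
  assumes "finite A" "A \<noteq> {}"
  obtains a where "a \<in> A" "max_linear n A z = eucl_inner n a z"
proof -
  have "max_linear n A z \<in> (\<lambda>a. eucl_inner n a z) ` A"
    unfolding max_linear_def using assms by (intro Max_in) auto
  then show ?thesis
    using that by auto
qed

lemma convex_on_max_linear: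
  assumes A: "finite A" "A \<noteq> {}" and "convex S"
  shows "convex_on S (max_linear n A)"
  unfolding convex_on_def
proof (intro conjI ballI allI impI \<open>convex S\<close>)
  fix x y :: "nat \<Rightarrow> real" and u v :: real
  assume uv: "0 \<le> u" "0 \<le> v"
  obtain a where a: "a \<in> A" "max_linear n A (u *\<^sub>R x + v *\<^sub>R y) = eucl_inner n a (u *\<^sub>R x + v *\<^sub>R y)"
    using max_linear_attained[OF A] .
  show "max_linear n A (u *\<^sub>R x + v *\<^sub>R y) \<le> u * max_linear n A x + v * max_linear n A y"
    using uv max_linear_ge[OF A(1) a(1)]
    by (simp add: a(2) eucl_inner_add_right eucl_inner_scaleR_right add_mono mult_left_mono)
qed

lemma active_in_subdifferential:
  assumes "finite A" "a \<in> A" "a \<in> topspace (Euclidean_space n)"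
    and "\<And>b. b \<in> A \<Longrightarrow> eucl_inner n b z \<le> eucl_inner n a z"
  shows "a \<in> subdifferential n D (max_linear n A) z"
proof -
  have "max_linear n A z = eucl_inner n a z"
    using assms max_linear_attained[of A n z] max_linear_ge[of A a n z] by (metis empty_iff order_antisym)
  then show ?thesis
    using assms max_linear_ge[of A a n]
    by (simp add: subdifferential_def eucl_inner_diff_right)
qed

text \<open>Test the subgradient inequality at \<open>z + g\<close>: the function rises by at least
  the squared norm of \<open>g\<close>, while by Cauchy-Schwarz no linear piece rises by more than
  \<open>B\<close> times that norm.\<close>

lemma bounded_subgradients_max_linear:
  assumes A: "finite A" "A \<noteq> {}" and bound: "\<And>a. a \<in> A \<Longrightarrow> eucl_norm n a \<le> B"
  shows "bounded_subgradients_on n (topspace (Euclidean_space n)) (max_linear n A) B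
           (topspace (Euclidean_space n))"
  unfolding bounded_subgradients_on_def
proof (intro ballI)
  fix z g
  assume z: "z \<in> topspace (Euclidean_space n)"
    and g: "g \<in> subdifferential n (topspace (Euclidean_space n)) (max_linear n A) z"
  then have "z + g \<in> topspace (Euclidean_space n)"
    by (simp add: subdifferential_def Euclidean_space_closed_under)
  with g have "max_linear n A z + eucl_inner n g (z + g - z) \<le> max_linear n A (z + g)"
    unfolding subdifferential_def by blast
  then have lower: "max_linear n A z + (eucl_norm n g)\<^sup>2 \<le> max_linear n A (z + g)"
    by (simp add: eucl_inner_self)
  obtain a where a: "a \<in> A" "max_linear n A (z + g) = eucl_inner n a (z + g)"
    using max_linear_attained[OF A] .
  have "eucl_inner n a g \<le> B * eucl_norm n g"
    using eucl_inner_le_norm[of n a g] mult_right_mono[OF bound[OF a(1)] eucl_norm_nonneg[of n g]]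
    by linarith
  then have "eucl_norm n g * eucl_norm n g \<le> B * eucl_norm n g"
    using lower max_linear_ge[OF A(1) a(1), of n z]
    by (simp add: a(2) eucl_inner_add_right power2_eq_square)
  \<comment> \<open>Covers the case of a zero norm, where the common factor cannot be
    cancelled.\<close>
  moreover have "0 \<le> B"
    using bound[OF a(1)] eucl_norm_nonneg[of n a] by linarith
  ultimately show "eucl_norm n g \<le> B"
    by (metis eucl_norm_nonneg mult_le_cancel_right order.strict_iff_order order.trans not_le)
qed

section \<open>The rate condition and its specialization to maxima of linear functionals\<close>

definition last_iterate_bound :: "real \<Rightarrow> real \<Rightarrow> (nat \<Rightarrow> real) \<Rightarrow> bool"
  where "last_iterate_bound B R h \<longleftrightarrow>
    (\<forall>(N::nat) (n::nat) (X :: (nat \<Rightarrow> real) set) (D :: (nat \<Rightarrow> real) set)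
       (f :: (nat \<Rightarrow> real) \<Rightarrow> real) (xstar :: nat \<Rightarrow> real)
       (x :: nat \<Rightarrow> nat \<Rightarrow> real) (g :: nat \<Rightarrow> nat \<Rightarrow> real).
       N \<ge> 1 \<and> n \<ge> 1 \<and>
       X \<noteq> {} \<and> closedin (Euclidean_space n) X \<and> convex X \<and>
       D \<subseteq> topspace (Euclidean_space n) \<and> convex_on D f \<and> X \<subseteq> D \<and>
       (\<forall>z\<in>X. subdifferential n D f z \<noteq> {}) \<and>
       bounded_subgradients_on n D f B X \<and>
       is_arg_min f (\<lambda>z. z \<in> X) xstar \<and>
       x 1 \<in> X \<and> eucl_norm n (x 1 - xstar) \<le> R \<and>
       (\<forall>k\<in>{1..N}. g k \<in> subdifferential n D f (x k) \<and>
                    x (k + 1) = eucl_proj n X (x k - h k *\<^sub>R g k))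
       \<longrightarrow> f (x (N + 1)) - f xstar \<le> B * R / sqrt (real (N + 1)))"

text \<open>Having \<open>0\<close> in \<open>A\<close> makes the function nonnegative with
  minimizer and minimum value 0, so the rate bounds every piece at the last iterate. Any piece
  active at \<open>x k\<close> may serve as \<open>g k\<close>; ties are what the adversary
  exploits.\<close>

lemma last_iterate_bound_max_linear:
  assumes h: "last_iterate_bound B R h" and "N \<ge> 1" "n \<ge> 1"
    and A: "finite A" "0 \<in> A" "A \<subseteq> topspace (Euclidean_space n)"
    and bound: "\<And>a. a \<in> A \<Longrightarrow> eucl_norm n a \<le> B"
    and x1: "x 1 \<in> topspace (Euclidean_space n)" "eucl_norm n (x 1) \<le> R"
    and step: "\<And>k. 1 \<le> k \<Longrightarrow> k \<le> N \<Longrightarrow> x (Suc k) = x k - h k *\<^sub>R g k"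
    and g: "\<And>k. 1 \<le> k \<Longrightarrow> k \<le> N \<Longrightarrow> g k \<in> A"
    and active: "\<And>k b. 1 \<le> k \<Longrightarrow> k \<le> N \<Longrightarrow> b \<in> A
                   \<Longrightarrow> eucl_inner n b (x k) \<le> eucl_inner n (g k) (x k)"
    and "a \<in> A"
  shows "eucl_inner n a (x (Suc N)) \<le> B * R / sqrt (real (N + 1))"
proof -
  let ?S = "topspace (Euclidean_space n)" and ?f = "max_linear n A"
  have ne: "A \<noteq> {}"
    using A by auto
  have f0: "?f 0 = 0"
    using max_linear_attained[OF A(1) ne, of n 0] by (auto simp: eucl_inner_def)
  have fpos: "?f z \<ge> 0" for z
    using max_linear_ge[OF A(1,2), of n z] by (simp add: eucl_inner_zero_left)
  have sub: "subdifferential n ?S ?f z \<noteq> {}" for z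
  proof -
    obtain b where b: "b \<in> A" "?f z = eucl_inner n b z"
      using max_linear_attained[OF A(1) ne] .
    then have "b \<in> subdifferential n ?S ?f z"
      using A max_linear_ge[OF A(1), of _ n z] by (intro active_in_subdifferential) auto
    then show ?thesis
      by auto
  qed
  have argmin: "is_arg_min ?f (\<lambda>z. z \<in> ?S) 0"
    using f0 fpos Euclidean_space_closed_under(1) by (simp add: is_arg_min_linorder)
  have gsub: "g k \<in> subdifferential n ?S ?f (x k)" if "1 \<le> k" "k \<le> N" for k
    using that A g active by (intro active_in_subdifferential) auto
  have xS: "k \<le> N \<Longrightarrow> x (Suc k) \<in> ?S" for k
  proof (induction k)
    case 0
    then show ?case using x1 by simp
  next
    case (Suc k)
    then have "x (Suc (Suc k)) = x (Suc k) - h (Suc k) *\<^sub>R g (Suc k)"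
      "g (Suc k) \<in> topspace (Euclidean_space n)"
      using step[of "Suc k"] g[of "Suc k"] A(3) by auto
    with Suc show ?case
      by (simp only: Euclidean_space_closed_under Suc_leD)
  qed
  have proj: "x (k + 1) = eucl_proj n ?S (x k - h k *\<^sub>R g k)" if "1 \<le> k" "k \<le> N" for k
    using that eucl_proj_topspace[OF xS[of k]] step[of k] by simp
  have "?S \<noteq> {}"
    using Euclidean_space_closed_under(1) by blast
  then have "?f (x (N + 1)) - ?f 0 \<le> B * R / sqrt (real (N + 1))"
    using h[unfolded last_iterate_bound_def, rule_format, of N n ?S ?S ?f 0 x g]
      \<open>N \<ge> 1\<close> \<open>n \<ge> 1\<close> Euclidean_space_closed_under(1)[of n] convex_topspace_Euclidean_space
      convex_on_max_linear[OF A(1) ne convex_topspace_Euclidean_space[of n], of n]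
      sub bounded_subgradients_max_linear[OF A(1) ne bound] argmin x1 gsub proj
    by auto
  then show ?thesis
    using max_linear_ge[OF A(1) \<open>a \<in> A\<close>, of n "x (Suc N)"] f0 by simp
qed

section \<open>Two explicit configurations in dimension three\<close>

definition vec3 :: "real \<Rightarrow> real \<Rightarrow> real \<Rightarrow> nat \<Rightarrow> real"
  where "vec3 a b c i = (if i = 0 then a else if i = 1 then b else if i = 2 then c else 0)"

lemma vec3_in_Euclidean_space: "vec3 a b c \<in> topspace (Euclidean_space 3)"
  by (simp add: vec3_def topspace_Euclidean_space)

lemma eucl_inner_vec3: "eucl_inner 3 (vec3 a b c) (vec3 a' b' c') = a * a' + b * b' + c * c'"
  by (simp add: eucl_inner_def vec3_def numeral_3_eq_3)

lemma eucl_norm_vec3_le_1: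
  assumes "a\<^sup>2 + b\<^sup>2 + c\<^sup>2 \<le> 1"
  shows "eucl_norm 3 (vec3 a b c) \<le> 1"
  using assms by (simp add: eucl_norm_def L2_set_def vec3_def numeral_3_eq_3)

lemma eucl_norm_scaleR_le:
  assumes "eucl_norm n a \<le> 1" "c \<ge> 0"
  shows "eucl_norm n (c *\<^sub>R a) \<le> c"
  using assms by (simp add: eucl_norm_scaleR mult_left_le)

lemma first_step_upper:
  fixes B R :: real
  assumes "B > 0" "R > 0" and h: "last_iterate_bound B R h"
  shows "h 1 * B < 9 / 25 * R"
proof -
  define e where "e = vec3 1 0 0"
  \<comment> \<open>The Pythagorean triple 20, 21, 29 gives exact rational unit vectors, whose inner
    product -41/841 is barely negative.\<close>
  define u where "u = vec3 (20/29) (21/29) 0"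
  define v where "v = vec3 (20/29) (-21/29) 0"
  define x where "x = (\<lambda>k::nat. if k = 1 then R *\<^sub>R e else R *\<^sub>R e - h 1 *\<^sub>R B *\<^sub>R u)"
  have mem: "e \<in> topspace (Euclidean_space 3)" "u \<in> topspace (Euclidean_space 3)"
      "v \<in> topspace (Euclidean_space 3)"
    by (simp_all add: e_def u_def v_def vec3_in_Euclidean_space)
  have norms: "eucl_norm 3 e \<le> 1" "eucl_norm 3 u \<le> 1" "eucl_norm 3 v \<le> 1"
    unfolding e_def u_def v_def by (rule eucl_norm_vec3_le_1, simp add: power2_eq_square)+
  have inner: "eucl_inner 3 u e = 20/29" "eucl_inner 3 v e = 20/29" "eucl_inner 3 v u = -41/841"
    by (simp_all add: e_def u_def v_def eucl_inner_vec3)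
  note inner_simps = eucl_inner_diff_right eucl_inner_scaleR_right eucl_inner_scaleR_left
    eucl_inner_zero_left inner
  have "eucl_inner 3 (B *\<^sub>R v) (x (Suc 1)) \<le> B * R / sqrt (real (1 + 1))"
  proof (rule last_iterate_bound_max_linear[OF h,
        where A = "{0, B *\<^sub>R u, B *\<^sub>R v}" and g = "\<lambda>_. B *\<^sub>R u"])
    show "eucl_norm 3 a \<le> B" if "a \<in> {0, B *\<^sub>R u, B *\<^sub>R v}" for a
      using that norms \<open>B > 0\<close> eucl_norm_scaleR_le[of 3 _ B] eucl_norm_scaleR[of 3 0 0] by auto
    show "eucl_inner 3 b (x k) \<le> eucl_inner 3 (B *\<^sub>R u) (x k)"
      if "1 \<le> k" "k \<le> 1" "b \<in> {0, B *\<^sub>R u, B *\<^sub>R v}" for k b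
      using that \<open>B > 0\<close> \<open>R > 0\<close> by (auto simp: x_def inner_simps)
  qed (use mem norms \<open>R > 0\<close> in \<open>auto simp: x_def le_Suc_eq Euclidean_space_closed_under eucl_norm_scaleR_le\<close>)
  then have "B * (20/29 * R + 41/841 * (h 1 * B)) \<le> B * (R / sqrt 2)"
    by (simp add: x_def inner_simps algebra_simps)
  then have *: "20/29 * R + 41/841 * (h 1 * B) \<le> R / sqrt 2"
    using \<open>B > 0\<close> by (simp only: mult_le_cancel_left_pos)
  \<comment> \<open>The difference from 20/29 gets multiplied by 841/41, about 20; the cruder bound
    1.414 would miss 9/25.\<close>
  have "1.41421 \<le> sqrt 2"
    by (rule real_le_rsqrt) (simp add: power2_eq_square)
  then have "R / sqrt 2 \<le> R / 1.41421"
    using \<open>R > 0\<close> by (intro divide_left_mono) auto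
  with * show ?thesis
    using \<open>R > 0\<close> by simp
qed

text \<open>The hypothesis \<open>h 1 * B \<le> R\<close> keeps the zero piece from exceeding
  \<open>v\<close> at the second iterate, so that \<open>v\<close> is a legal subgradient
  there.\<close>

lemma first_step_lower:
  fixes B R :: real
  assumes "B > 0" "R > 0" and h: "last_iterate_bound B R h"
    and "h 1 > 0" "h 2 > 0" and small: "h 1 * B \<le> R"
  shows "h 1 * B > 37 / 100 * R"
proof -
  define e where "e = vec3 1 0 0"
  \<comment> \<open>Here 0.59 slightly exceeds 1/sqrt 3; the other entries keep the norms just below
    1, make \<open>c\<close> small and positive, and make the inner product of \<open>v\<close> and
    \<open>w\<close> slightly negative.\<close>
  define u where "u = vec3 0.59 (-0.8074) 0"
  define v where "v = vec3 0.59 0.3895 0.7072"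
  define w where "w = vec3 0.59 0.3895 (-0.7072)"
  define x2 where "x2 = R *\<^sub>R e - h 1 *\<^sub>R B *\<^sub>R u"
  define x where "x = (\<lambda>k::nat. if k = 1 then R *\<^sub>R e else if k = 2 then x2 else x2 - h 2 *\<^sub>R B *\<^sub>R v)"
  define g where "g = (\<lambda>k::nat. if k = 1 then B *\<^sub>R u else B *\<^sub>R v)"
  define c :: real where "c = 0.0336177"
  define d :: real where "d = 0.00032159"
  have mem: "e \<in> topspace (Euclidean_space 3)" "u \<in> topspace (Euclidean_space 3)"
      "v \<in> topspace (Euclidean_space 3)" "w \<in> topspace (Euclidean_space 3)"
    by (simp_all add: e_def u_def v_def w_def vec3_in_Euclidean_space)
  have norms: "eucl_norm 3 e \<le> 1" "eucl_norm 3 u \<le> 1" "eucl_norm 3 v \<le> 1" "eucl_norm 3 w \<le> 1"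
    unfolding e_def u_def v_def w_def by (rule eucl_norm_vec3_le_1, simp add: power2_eq_square)+
  have inner: "eucl_inner 3 u e = 59/100" "eucl_inner 3 v e = 59/100" "eucl_inner 3 w e = 59/100"
      "eucl_inner 3 v u = c" "eucl_inner 3 w u = c" "eucl_inner 3 w v = - d"
    by (simp_all add: e_def u_def v_def w_def c_def d_def eucl_inner_vec3)
  \<comment> \<open>The first step lowers \<open>u\<close> at least as much as \<open>v\<close> and
    \<open>w\<close>, which stay tied.\<close>
  have uu: "eucl_inner 3 u u \<ge> c"
    by (simp add: u_def c_def eucl_inner_vec3)
  note inner_simps = eucl_inner_diff_right eucl_inner_scaleR_right eucl_inner_scaleR_left
    eucl_inner_zero_left inner
  have hB: "h 1 * B > 0"
    using assms by simp
  have active2: "h 1 * (B * c) \<le> R * 59 / 100"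
    using small hB \<open>R > 0\<close> by (simp add: c_def mult.commute[of B])
  have "eucl_inner 3 (B *\<^sub>R w) (x (Suc 2)) \<le> B * R / sqrt (real (2 + 1))"
  proof (rule last_iterate_bound_max_linear[OF h,
        where A = "{0, B *\<^sub>R u, B *\<^sub>R v, B *\<^sub>R w}" and g = g])
    show "eucl_norm 3 a \<le> B" if "a \<in> {0, B *\<^sub>R u, B *\<^sub>R v, B *\<^sub>R w}" for a
      using that norms \<open>B > 0\<close> eucl_norm_scaleR_le[of 3 _ B] eucl_norm_scaleR[of 3 0 0] by auto
    show "eucl_inner 3 b (x k) \<le> eucl_inner 3 (g k) (x k)"
      if k: "1 \<le> k" "k \<le> 2" and b: "b \<in> {0, B *\<^sub>R u, B *\<^sub>R v, B *\<^sub>R w}" for k b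
    proof -
      consider "k = 1" | "k = 2"
        using k by linarith
      then show ?thesis
      proof cases
        case 1
        then show ?thesis
          using b \<open>B > 0\<close> \<open>R > 0\<close> by (auto simp: x_def g_def inner_simps)
      next
        case 2
        then show ?thesis
          using b \<open>B > 0\<close> \<open>R > 0\<close> \<open>h 1 > 0\<close> active2 uu
          by (auto simp: x_def x2_def g_def inner_simps)
      qed
    qed
  qed (use mem norms \<open>R > 0\<close> in
      \<open>auto simp: x_def x2_def g_def le_Suc_eq numeral_2_eq_2 Euclidean_space_closed_under eucl_norm_scaleR_le\<close>)
  moreover have "eucl_inner 3 (B *\<^sub>R w) (x (Suc 2)) = B * (59/100 * R - h 1 * B * c + h 2 * B * d)"
    by (simp add: x_def x2_def inner_simps) (simp add: algebra_simps)
  ultimately have "B * (59/100 * R - h 1 * B * c + h 2 * B * d) \<le> B * (R / sqrt 3)"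
    by simp
  then have "59/100 * R - h 1 * B * c + h 2 * B * d \<le> R / sqrt 3"
    using \<open>B > 0\<close> by (simp only: mult_le_cancel_left_pos)
  \<comment> \<open>Moving along \<open>v\<close> cannot lower \<open>w\<close>, so the second step
    size drops out.\<close>
  moreover have "h 2 * B * d \<ge> 0"
    using \<open>h 2 > 0\<close> \<open>B > 0\<close> by (simp add: d_def)
  ultimately have *: "59/100 * R - h 1 * B * c \<le> R / sqrt 3"
    by linarith
  have "1.732 \<le> sqrt 3"
    by (rule real_le_rsqrt) (simp add: power2_eq_square)
  then have "R / sqrt 3 \<le> R / 1.732"
    using \<open>R > 0\<close> by (intro divide_left_mono) auto
  with * show ?thesis
    using \<open>R > 0\<close> by (simp add: c_def)
qed

theorem mainTheorem8:
  fixes B R :: real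
  assumes "B > 0" and "R > 0"
  shows "\<not> (\<exists>h :: nat \<Rightarrow> real. (\<forall>k\<ge>1. h k > 0) \<and>
    (\<forall>(N::nat) (n::nat) (X :: (nat \<Rightarrow> real) set) (D :: (nat \<Rightarrow> real) set)
       (f :: (nat \<Rightarrow> real) \<Rightarrow> real) (xstar :: nat \<Rightarrow> real)
       (x :: nat \<Rightarrow> nat \<Rightarrow> real) (g :: nat \<Rightarrow> nat \<Rightarrow> real).
       N \<ge> 1 \<and> n \<ge> 1 \<and>
       X \<noteq> {} \<and> closedin (Euclidean_space n) X \<and> convex X \<and>
       D \<subseteq> topspace (Euclidean_space n) \<and> convex_on D f \<and> X \<subseteq> D \<and>
       (\<forall>z\<in>X. subdifferential n D f z \<noteq> {}) \<and>
       bounded_subgradients_on n D f B X \<and>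
       is_arg_min f (\<lambda>z. z \<in> X) xstar \<and>
       x 1 \<in> X \<and> eucl_norm n (x 1 - xstar) \<le> R \<and>
       (\<forall>k\<in>{1..N}. g k \<in> subdifferential n D f (x k) \<and>
                    x (k + 1) = eucl_proj n X (x k - h k *\<^sub>R g k))
       \<longrightarrow> f (x (N + 1)) - f xstar \<le> B * R / sqrt (real (N + 1))))"
  \<comment> \<open>The definition repeats the quantified condition literally, so the goal folds
    into it.\<close>
  unfolding last_iterate_bound_def[symmetric]
proof
  assume "\<exists>h. (\<forall>k\<ge>1. h k > 0) \<and> last_iterate_bound B R h"
  then obtain h where h: "\<forall>k\<ge>1. h k > 0" "last_iterate_bound B R h"
    by blast
  have "h 1 * B < 9 / 25 * R"
    using first_step_upper assms h(2) .
  \<comment> \<open>The upper bound just obtained discharges \<open>h 1 * B \<le> R\<close>; the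
    contradiction is 37/100 > 9/25.\<close>
  moreover from this have "h 1 * B > 37 / 100 * R"
    using assms h by (intro first_step_lower) auto
  ultimately show False
    using \<open>R > 0\<close> by linarith
qed

end
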